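(* Let $p(z)$ be a monic cubic polynomial with complex coefficients having distinct roots and distinct critical points. Then there is a solution $c$ of $p'(z)=0$ such that the sequence $B_m(c)$, $m=2,3,\dots$, converges to a root of $p(z)$.
   Context: For $\xi\in\mathbb{C}$, the sequence $B_m(\xi)$, $m=2,3,\dots$, is given by $B_m(\xi)=\xi-p(\xi)\,\frac{d_{m-2}}{d_{m-1}}$, where $d_m$ satisfies the recurrence $d_m=p'(\xi)\,d_{m-1}-0.5\,p(\xi)\,p''(\xi)\,d_{m-2}+p^2(\xi)\,d_{m-3}$, with $d_0=1$ and $d_{-1}=d_{-2}=0$. Here $p^2(\xi)$ denotes $(p(\xi))^2$. The critical points of $p(z)$ are the solutions of $p'(z)=0$. *)

theory Defs
  imports Complex_Main "HOL-Computational_Algebra.Polynomial"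
begin

text \<open>The index is an integer so that the initial values at \<open>-1\<close> and \<open>-2\<close> can be stated as such.
  The values below \<open>-2\<close> are never used.\<close>

function basic_d :: "complex poly \<Rightarrow> complex \<Rightarrow> int \<Rightarrow> complex" where
  "basic_d p \<xi> m =
    (if m < 0 then 0
     else if m = 0 then 1
     else poly (pderiv p) \<xi> * basic_d p \<xi> (m - 1)
          - 1 / 2 * poly p \<xi> * poly (pderiv (pderiv p)) \<xi> * basic_d p \<xi> (m - 2)
          + (poly p \<xi>)\<^sup>2 * basic_d p \<xi> (m - 3))"
  by pat_completeness auto
termination
  by (relation "measure (\<lambda>(p, \<xi>, m). nat (m + 3))") auto

declare basic_d.simps [simp del]

text \<open>If \<open>d\<^bsub>m-1\<^esub> = 0\<close>, the term is undefined in ordinary mathematics; here it is \<open>\<xi>\<close>, because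
  \<open>x / 0 = 0\<close>.  At a critical point this always happens for \<open>m = 2\<close>, since \<open>d\<^bsub>1\<^esub> = p'(\<xi>)\<close>.
  This does not weaken convergence to a root when \<open>p(\<xi>) \<noteq> 0\<close> (in particular at a critical point
  of a polynomial with distinct roots): infinitely many undefined terms would force the limit to
  be \<open>\<xi>\<close>, which is not a root.\<close>

definition basic_B :: "nat \<Rightarrow> complex poly \<Rightarrow> complex \<Rightarrow> complex" where
  "basic_B m p \<xi> = \<xi> - poly p \<xi> * (basic_d p \<xi> (int m - 2) / basic_d p \<xi> (int m - 1))"

end

theory Submission
  imports Defs
begin

text \<open>With \<open>u, v, w\<close> the products of \<open>c - \<theta>\<close> over two of the three roots each, the recurrence for
  \<open>d\<close> has characteristic roots \<open>u, v, w\<close>, so \<open>d\<^bsub>m\<^esub>\<close> is the complete homogeneous symmetric polynomial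
  of degree \<open>m\<close> in them.  The largest of them belongs to the root nearest to \<open>c\<close>; if that root is
  strictly nearest, then \<open>B\<^bsub>m\<^esub>(c)\<close> converges to it.
  If instead two roots tie for nearest to a critical point \<open>c\<close>, move \<open>c\<close> to \<open>0\<close> and the third root
  to \<open>1\<close>.  Then \<open>p'(0) = 0\<close> forces the tied roots to be complex conjugate, and an explicit computation
  shows that the third root is strictly nearest to the other critical point.\<close>

text \<open>The exponents are shifted by 2 so that the initial values at \<open>-2, -1, 0\<close> start the induction.\<close>

lemma basic_d_closed_form:
  fixes x y z c :: complex
  assumes p: "p = [:-x, 1:] * [:-y, 1:] * [:-z, 1:]"
  defines "u \<equiv> (c - y) * (c - z)" and "v \<equiv> (c - x) * (c - z)" and "w \<equiv> (c - x) * (c - y)"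
  shows "basic_d p c (int n - 2) * ((u - v) * (u - w) * (v - w))
           = u ^ n * (v - w) - v ^ n * (u - w) + w ^ n * (u - v)"
proof (induction n rule: less_induct)
  case (less n)
  have pc: "poly p c = (c - x) * (c - y) * (c - z)"
    and p'c: "poly (pderiv p) c = u + v + w"
    and p''c: "poly (pderiv (pderiv p)) c = 2 * ((c - x) + (c - y) + (c - z))"
    unfolding p u_def v_def w_def by (simp_all add: pderiv_mult pderiv_pCons algebra_simps)
  \<comment> \<open>The coefficients of the recurrence are the elementary symmetric polynomials of
    \<open>u\<close>, \<open>v\<close>, \<open>w\<close>, so the sequences \<open>u ^ n\<close>,
    \<open>v ^ n\<close>, \<open>w ^ n\<close> all satisfy it.\<close>
  have e2: "1 / 2 * poly p c * poly (pderiv (pderiv p)) c = u * v + u * w + v * w"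
    unfolding pc p''c u_def v_def w_def by (simp add: algebra_simps)
  have e3: "(poly p c)\<^sup>2 = u * v * w"
    unfolding pc u_def v_def w_def by (simp add: power2_eq_square algebra_simps)
  consider "n = 0" | "n = 1" | "n = 2" | k where "n = k + 3"
  proof -
    have "n = 0 \<or> n = 1 \<or> n = 2 \<or> n = (n - 3) + 3" by linarith
    then show ?thesis using that by blast
  qed
  then show ?case
  proof cases
    case 4
    have "basic_d p c (int n - 2) = (u + v + w) * basic_d p c (int (k + 2) - 2)
        - (u * v + u * w + v * w) * basic_d p c (int (k + 1) - 2)
        + u * v * w * basic_d p c (int k - 2)"
      unfolding 4 e3[symmetric] e2[symmetric] p'c[symmetric]
      by (subst basic_d.simps) simp
    then have "basic_d p c (int n - 2) * ((u - v) * (u - w) * (v - w)) =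
        (u + v + w) * (basic_d p c (int (k + 2) - 2) * ((u - v) * (u - w) * (v - w)))
        - (u * v + u * w + v * w) * (basic_d p c (int (k + 1) - 2) * ((u - v) * (u - w) * (v - w)))
        + u * v * w * (basic_d p c (int k - 2) * ((u - v) * (u - w) * (v - w)))"
      by algebra
    also have "\<dots> = (u + v + w) * (u ^ (k + 2) * (v - w) - v ^ (k + 2) * (u - w) + w ^ (k + 2) * (u - v))
        - (u * v + u * w + v * w) * (u ^ (k + 1) * (v - w) - v ^ (k + 1) * (u - w) + w ^ (k + 1) * (u - v))
        + u * v * w * (u ^ k * (v - w) - v ^ k * (u - w) + w ^ k * (u - v))"
      using less.IH[of "k + 2"] less.IH[of "k + 1"] less.IH[of k] 4 by simp
    also have "\<dots> = u ^ n * (v - w) - v ^ n * (u - w) + w ^ n * (u - v)"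
      unfolding 4 by (simp add: power_add eval_nat_numeral algebra_simps)
    finally show ?thesis .
  qed (simp_all add: basic_d.simps power2_eq_square algebra_simps)
qed

text \<open>Since \<open>u\<close> dominates \<open>v\<close> and \<open>w\<close>, the quotient of
  consecutive values of \<open>basic_d\<close> tends to \<open>1 / u\<close>, and p(c) = (c - x) u
  turns this into the limit \<open>x\<close>.\<close>

lemma basic_B_tendsto_nearest_root:
  fixes x y z :: complex
  assumes p: "p = [:-x, 1:] * [:-y, 1:] * [:-z, 1:]"
    and "y \<noteq> z" and near: "cmod (c - x) < cmod (c - y)" "cmod (c - x) < cmod (c - z)"
  shows "(\<lambda>n. basic_B (n + 2) p c) \<longlonglongrightarrow> x"
proof (cases "c = x")
  \<comment> \<open>Treated apart because \<open>v = w = 0\<close> here, so the Vandermonde factor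
    vanishes.\<close>
  case True
  then have "poly p c = 0" by (simp add: p del: mult_pCons_left mult_pCons_right)
  then show ?thesis using True by (simp add: basic_B_def)
next
  case False
  define u where "u = (c - y) * (c - z)"
  define v where "v = (c - x) * (c - z)"
  define w where "w = (c - x) * (c - y)"
  define V where "V = (u - v) * (u - w) * (v - w)"
  define f where "f n = basic_d p c (int n - 2)" for n
  have ne: "c \<noteq> x" "c \<noteq> y" "c \<noteq> z" "x \<noteq> y" "x \<noteq> z"
    using False near by auto
  have "u \<noteq> 0" using ne by (simp add: u_def)
  have "u - v = (c - z) * (x - y)" "u - w = (c - y) * (x - z)" and vw: "v - w = (c - x) * (y - z)"
    by (simp_all add: u_def v_def w_def algebra_simps)
  then have "V \<noteq> 0" "v - w \<noteq> 0" using ne \<open>y \<noteq> z\<close> by (simp_all add: V_def)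
  \<comment> \<open>The quotients are (c - x) / (c - y) and (c - x) / (c - z).\<close>
  have uvw: "cmod (v / u) < 1" "cmod (w / u) < 1"
    using near ne by (simp_all add: u_def v_def w_def norm_mult norm_divide)
  have f: "f n / u ^ n = ((v - w) - (v / u) ^ n * (u - w) + (w / u) ^ n * (u - v)) / V" for n
  proof -
    have "f n * V = u ^ n * (v - w) - v ^ n * (u - w) + w ^ n * (u - v)"
      using basic_d_closed_form[OF p, of c n]
      unfolding f_def V_def u_def v_def w_def .
    also have "\<dots> = u ^ n * ((v - w) - (v / u) ^ n * (u - w) + (w / u) ^ n * (u - v))"
      using \<open>u \<noteq> 0\<close> by (simp add: power_divide distrib_left right_diff_distrib)
    finally show ?thesis
      using \<open>u \<noteq> 0\<close> \<open>V \<noteq> 0\<close> by (simp add: divide_eq_eq eq_divide_eq mult.commute)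
  qed
  have "(\<lambda>n. f n / u ^ n) \<longlonglongrightarrow> ((v - w) - 0 * (u - w) + 0 * (u - v)) / V"
    unfolding f using uvw \<open>V \<noteq> 0\<close> by (intro tendsto_intros LIMSEQ_power_zero)
  then have lim: "(\<lambda>n. f n / u ^ n) \<longlonglongrightarrow> (v - w) / V" by simp
  define h where "h n = f n / u ^ n" for n
  have L: "(v - w) / V \<noteq> 0" using \<open>V \<noteq> 0\<close> \<open>v - w \<noteq> 0\<close> by simp
  have h: "(\<lambda>n. h (n + k)) \<longlonglongrightarrow> (v - w) / V" for k
    using lim unfolding h_def[symmetric] by (rule LIMSEQ_ignore_initial_segment)
  have "(\<lambda>n. h (n + 2) / h (n + 3)) \<longlonglongrightarrow> (v - w) / V / ((v - w) / V)"
    by (rule tendsto_divide[OF h h L])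
  then have "(\<lambda>n. h (n + 2) / h (n + 3)) \<longlonglongrightarrow> 1" using L by simp
  then have "(\<lambda>n. c - poly p c * (h (n + 2) / h (n + 3) / u)) \<longlonglongrightarrow> c - poly p c * (1 / u)"
    by (intro tendsto_diff tendsto_mult tendsto_const tendsto_divide[OF _ tendsto_const \<open>u \<noteq> 0\<close>])
  moreover have "poly p c = (c - x) * u"
    by (simp add: p u_def algebra_simps)
  then have "c - poly p c * (1 / u) = x"
    using \<open>u \<noteq> 0\<close> by simp
  \<comment> \<open>This holds for every \<open>n\<close>: if \<open>f (n + 3) = 0\<close>, both
    quotients are 0.\<close>
  moreover have "basic_B (n + 2) p c = c - poly p c * (h (n + 2) / h (n + 3) / u)" for n
  proof -
    have "u ^ (n + 3) = u ^ (n + 2) * u" by (simp add: eval_nat_numeral)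
    then show ?thesis
      using \<open>u \<noteq> 0\<close> by (simp add: basic_B_def h_def f_def)
  qed
  ultimately show ?thesis by simp
qed

text \<open>The first two hypotheses encode p'(c) = 0 and Vieta's formula for the sum of the
  critical points of the cubic with roots \<open>x\<close>, \<open>y\<close>,
  \<open>z\<close>.\<close>

lemma equidistant_critical_point_imp_nearer:
  fixes x y z c c' :: complex
  assumes "(c - x) * (c - y) + (c - x) * (c - z) + (c - y) * (c - z) = 0"
    and other: "3 * (c + c') = 2 * (x + y + z)" and "c \<noteq> c'"
    and "c \<noteq> z" "x \<noteq> y"
    and tie: "cmod (c - x) = cmod (c - y)" "cmod (c - x) \<le> cmod (c - z)"
  shows "cmod (c' - z) < cmod (c' - x) \<and> cmod (c' - z) < cmod (c' - y)"
proof -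
  \<comment> \<open>The affine map sending \<open>c\<close> to 0 and \<open>z\<close> to 1 sends
    \<open>x\<close>, \<open>y\<close>, \<open>c'\<close> to \<open>a\<close>, \<open>b\<close>,
    \<open>m\<close>.\<close>
  define k where "k = z - c"
  define a where "a = (x - c) / k"
  define b where "b = (y - c) / k"
  have "k \<noteq> 0" using \<open>c \<noteq> z\<close> by (simp add: k_def)
  then have x: "x = c + k * a" and y: "y = c + k * b" and z: "z = c + k"
    by (simp_all add: a_def b_def k_def)
  have "k\<^sup>2 * (a * b + a + b) = 0"
    using assms(1) unfolding x y z by (simp add: power2_eq_square algebra_simps)
  then have ab: "a * b + a + b = 0" using \<open>k \<noteq> 0\<close> by simp
  have ab_norm: "cmod a = cmod b" "cmod a \<le> 1"
    using tie \<open>k \<noteq> 0\<close> unfolding x y z by (simp_all add: norm_mult)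
  define m where "m = 2 / 3 * (1 + a + b)"
  have c': "c' = c + k * m"
    using other unfolding x y z m_def by (simp add: field_simps)
  have "m \<noteq> 0" using \<open>c \<noteq> c'\<close> c' by auto
  have "a \<noteq> 0"
    using ab_norm(1) \<open>x \<noteq> y\<close> unfolding x y by auto
  define s where "s = Re a"
  have b: "b * (1 + a) = - a" using ab by (simp add: algebra_simps eq_neg_iff_add_eq_0)
  then have "1 + a \<noteq> 0" using \<open>a \<noteq> 0\<close> by auto
  \<comment> \<open>As |a| = |b| is nonzero, taking norms puts \<open>1 + a\<close> on the unit
    circle.\<close>
  have "cmod b * cmod (1 + a) = cmod a" by (metis b norm_mult norm_minus_cancel)
  then have "cmod (1 + a) = 1" using ab_norm(1) \<open>a \<noteq> 0\<close> by auto
  then have circle: "2 * s + (cmod a)\<^sup>2 = 0"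
    using cmod_power2[of "1 + a"] cmod_power2[of a]
    by (simp add: s_def power2_eq_square algebra_simps)
  \<comment> \<open>\<open>cnj a\<close> solves the same linear equation as
    \<open>b\<close>.\<close>
  have "cnj a * (1 + a) = cnj a + of_real ((cmod a)\<^sup>2)"
    by (simp add: algebra_simps complex_norm_square del: of_real_power)
  also have "\<dots> = - a"
    using circle by (simp add: complex_eq_iff s_def)
  finally have "cnj a * (1 + a) = b * (1 + a)" using b by simp
  then have "b = cnj a" using \<open>1 + a \<noteq> 0\<close> by simp
  then have m: "m = of_real (2 / 3 * (1 + 2 * s))"
    by (simp add: m_def complex_eq_iff s_def)
  have "s < 0" using circle \<open>a \<noteq> 0\<close> by (smt (verit) zero_less_norm_iff zero_less_power)
  \<comment> \<open>|a| \<le> 1 gives the weak inequality; equality would mean m = 0, that is, c' =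
    c.\<close>
  moreover have "- 1 / 2 < s"
  proof -
    have "(cmod a)\<^sup>2 \<le> 1" using ab_norm(2) by (simp add: power_le_one)
    moreover have "1 + 2 * s \<noteq> 0" using \<open>m \<noteq> 0\<close> unfolding m of_real_eq_0_iff by simp
    ultimately show ?thesis using circle by linarith
  qed
  ultimately have "0 < (1 - 4 * s) * (1 + 2 * s)" by (intro mult_pos_pos) auto
  moreover have "(cmod (m - a))\<^sup>2 - (cmod (m - 1))\<^sup>2 = (1 - 4 * s) * (1 + 2 * s) / 3"
    using circle cmod_power2[of a] unfolding cmod_power2 m
    by (simp add: s_def[symmetric] power2_eq_square field_simps)
  ultimately have "(cmod (m - 1))\<^sup>2 < (cmod (m - a))\<^sup>2" by linarith
  then have "cmod (m - 1) < cmod (m - a)" by (rule power_less_imp_less_base) simp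
  moreover have "cmod (m - b) = cmod (m - a)"
    unfolding m \<open>b = cnj a\<close> by (simp add: cmod_def)
  moreover have "c' - x = k * (m - a)" "c' - y = k * (m - b)" "c' - z = k * (m - 1)"
    unfolding c' x y z by (simp_all add: algebra_simps)
  ultimately show ?thesis using \<open>k \<noteq> 0\<close> by (simp add: norm_mult)
qed

theorem mainTheorem3:
  fixes p :: "complex poly"
  assumes "degree p = 3"
    and "lead_coeff p = 1"
    and "card {z. poly p z = 0} = 3"
    and "card {z. poly (pderiv p) z = 0} = 2"
  shows "\<exists>c \<theta>. poly (pderiv p) c = 0 \<and> poly p \<theta> = 0 \<and>
           (\<lambda>n. basic_B (n + 2) p c) \<longlonglongrightarrow> \<theta>"
proof -
  obtain r1 r2 r3 where roots: "{z. poly p z = 0} = {r1, r2, r3}"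
    and distinct: "r1 \<noteq> r2" "r2 \<noteq> r3" "r1 \<noteq> r3"
    using assms(3) by (auto simp: card_3_iff)
  obtain c c' where crit: "{z. poly (pderiv p) z = 0} = {c, c'}" and "c \<noteq> c'"
    using assms(4) by (auto simp: card_2_iff)
  have p: "p = [:-r1, 1:] * [:-r2, 1:] * [:-r3, 1:]"
  \<comment> \<open>Two cubics with equal leading coefficient that agree at three points are
    equal.\<close>
  proof (rule poly_eqI_degree_lead_coeff[where n = 3 and A = "{r1, r2, r3}"])
    show "coeff p 3 = coeff ([:-r1, 1:] * [:-r2, 1:] * [:-r3, 1:]) 3"
      using assms(1,2) by (simp add: eval_nat_numeral)
    show "degree ([:-r1, 1:] * [:-r2, 1:] * [:-r3, 1:]) \<le> 3" by simp
    show "poly p z = poly ([:-r1, 1:] * [:-r2, 1:] * [:-r3, 1:]) z" if "z \<in> {r1, r2, r3}" for z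
      using that roots by (auto simp del: mult_pCons_left mult_pCons_right)
  qed (use assms(1) distinct in auto)
  have nearest: ?thesis
    if "p = [:-x, 1:] * [:-y, 1:] * [:-z, 1:]" "y \<noteq> z" "poly (pderiv p) e = 0"
      "cmod (e - x) < cmod (e - y)" "cmod (e - x) < cmod (e - z)" for x y z e
  proof -
    have "poly p x = 0" by (simp add: that(1) del: mult_pCons_left mult_pCons_right)
    with basic_B_tendsto_nearest_root[OF that(1,2,4,5)] that(3) show ?thesis by blast
  qed
  have tie: ?thesis
    if q: "p = [:-x, 1:] * [:-y, 1:] * [:-z, 1:]" and "x \<noteq> y"
      and le: "cmod (c - x) = cmod (c - y)" "cmod (c - x) \<le> cmod (c - z)" for x y z
  proof -
    have deriv: "poly (pderiv p) e = (e - x) * (e - y) + (e - x) * (e - z) + (e - y) * (e - z)" for e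
      unfolding q by (simp add: pderiv_mult pderiv_pCons algebra_simps)
    have crit0: "poly (pderiv p) c = 0" "poly (pderiv p) c' = 0" using crit by auto
    \<comment> \<open>The left side is p'(c) - p'(c').\<close>
    have "(c - c') * (3 * (c + c') - 2 * (x + y + z)) = 0"
      using crit0 unfolding deriv by algebra
    then have "3 * (c + c') = 2 * (x + y + z)" using \<open>c \<noteq> c'\<close> by simp
    \<comment> \<open>If \<open>c = z\<close>, both tied distances would be 0, forcing
      \<open>x = y\<close>.\<close>
    moreover have "c \<noteq> z" using le \<open>x \<noteq> y\<close> by auto
    ultimately have "cmod (c' - z) < cmod (c' - x) \<and> cmod (c' - z) < cmod (c' - y)"
      using equidistant_critical_point_imp_nearer[of c x y z c'] crit0(1) \<open>c \<noteq> c'\<close> \<open>x \<noteq> y\<close> le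
      unfolding deriv by blast
    moreover have "p = [:-z, 1:] * [:-x, 1:] * [:-y, 1:]"
      unfolding q by (simp only: mult_ac)
    ultimately show ?thesis
      using nearest \<open>x \<noteq> y\<close> crit0(2) by blast
  qed
  have perm: "p = [:-r2, 1:] * [:-r1, 1:] * [:-r3, 1:]" "p = [:-r3, 1:] * [:-r1, 1:] * [:-r2, 1:]"
    "p = [:-r1, 1:] * [:-r3, 1:] * [:-r2, 1:]" "p = [:-r2, 1:] * [:-r3, 1:] * [:-r1, 1:]"
    unfolding p by (simp_all only: mult_ac)
  have crit0: "poly (pderiv p) c = 0" using crit by auto
  \<comment> \<open>Either one root is strictly nearest to \<open>c\<close>, or two roots attain the
    minimal distance; a triple tie falls under the latter.\<close>
  consider "cmod (c - r1) < cmod (c - r2)" "cmod (c - r1) < cmod (c - r3)"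
    | "cmod (c - r2) < cmod (c - r1)" "cmod (c - r2) < cmod (c - r3)"
    | "cmod (c - r3) < cmod (c - r1)" "cmod (c - r3) < cmod (c - r2)"
    | "cmod (c - r1) = cmod (c - r2)" "cmod (c - r1) \<le> cmod (c - r3)"
    | "cmod (c - r1) = cmod (c - r3)" "cmod (c - r1) \<le> cmod (c - r2)"
    | "cmod (c - r2) = cmod (c - r3)" "cmod (c - r2) \<le> cmod (c - r1)"
    by linarith
  then show ?thesis
  proof cases
    case 1
    with nearest[OF p] crit0 distinct show ?thesis by blast
  next
    case 2
    with nearest[OF perm(1)] crit0 distinct show ?thesis by blast
  next
    case 3
    with nearest[OF perm(2)] crit0 distinct show ?thesis by blast
  next
    case 4
    with tie[OF p] distinct show ?thesis by blast
  next
    case 5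
    with tie[OF perm(3)] distinct show ?thesis by blast
  next
    case 6
    with tie[OF perm(4)] distinct show ?thesis by blast
  qed
qed

end
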